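(* The semi-discretization of the two-dimensional Euler equations on the periodic domain $\Omega=[0,1]^2$ given by $$\frac{d u_h}{dt} + \left[\overline{D}_x\circ F_x(u_h)\right]\mathbf{1} + \left[\overline{D}_y\circ F_y(u_h)\right]\mathbf{1} = -\overline{H}^{-1}\left[\sum_{\kappa=1}^{K}\overline{R}_\kappa^T\,\overline{P}_\kappa^T\,\overline{H}_\kappa A_\kappa\,\overline{P}_\kappa\,\overline{R}_\kappa\right]w_h$$ is entropy stable, i.e. $\frac{d}{dt}\left(\mathbf{1}^T H s_h\right)\le 0$, if the product $\overline{H}_\kappa A_\kappa$ is symmetric positive semi-definite (for each element $\kappa$).
   Context: Euler equations: $\partial_t \mathcal{U}+\partial_x\mathcal{F}_x+\partial_y\mathcal{F}_y=0$ with periodic boundary conditions. Here $\mathcal{U}=[\rho,\rho u,\rho v,e]^T$, $\mathcal{F}_x=[\rho u,\rho u^2+p,\rho uv,(e+p)u]^T$, $\mathcal{F}_y=[\rho v,\rho vu,\rho v^2+p,(e+p)v]^T$, $p=(\gamma-1)[e-\tfrac{\rho}{2}(u^2+v^2)]$, $\gamma=1.4$. Density and pressure are assumed positive. Entropy: $\mathcal{S}=-\rho s/(\gamma-1)$ with $s=\ln(p/\rho^\gamma)$. The entropy variables are $\mathcal{W}(\mathcal U)=\partial\mathcal{S}/\partial\mathcal{U}=\left[\frac{\gamma-s}{\gamma-1}-\frac12\frac{\rho}{p}(u^2+v^2),\ \frac{\rho u}{p},\ \frac{\rho v}{p},\ -\frac{\rho}{p}\right]^T$. The potential fluxes are $\psi_x=\rho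 u$, $\psi_y=\rho v$. Mesh and global solution: $\Omega$ is divided into $K$ elements, element $\kappa$ having $n_\kappa$ nodes; there are $n$ global nodes, and nodes shared by adjacent elements carry a single value (continuous solution). $u_h\in\mathbb{R}^{4n}$ stacks the nodal states $u_1,\dots,u_n\in\mathbb{R}^4$; $w_h\in\mathbb{R}^{4n}$ stacks the entropy variables $\mathcal{W}(u_1),\dots,\mathcal{W}(u_n)$; $s_h\in\mathbb{R}^n$ holds the nodal values of $\mathcal{S}$. $R_\kappa\in\mathbb{R}^{n_\kappa\times n}$ restricts global (scalar) nodal vectors to the nodes of element $\kappa$; each of its rows is a single transposed standard basis vector. $\mathbf{1}$ is a vector of ones of the appropriate size. SBP operators: on each element (in physical space), $Q_{x,\kappa}=S_{x,\kappa}+\tfrac12E_{x,\kappa}$ with $S_{x,\kappa}^T=-S_{x,\kappa}$ and $E_{x,\kappa}^T=E_{x,\kappa}$; similarly for $y$. As derivative operators they are exact for constants: $Q_{x,\kappa}\mathbf{1}=0$, $Q_{y,\kappa}\mathbf{1}=0$. The boundary matrices cancel at element interfaces: $\sum_\kappa R_\kappa^TE_{x,\kappa}R_\kappa=\sum_\kappa R_\kappa^TE_{y,\kappa}R_\kappa=0$. $H_\kappa$ is the diagonal positive-definite element norm matrix (cubature weights on the reference element). The global norm $H$ is the diagonal positive-definite $n\times n$ matrix assembled from the element norm matrices (scaled by the positive mapping Jacobian determinants) by $\sum_\kappa R_\kappa^T(\cdot)R_\kappa$. The global operators are $D_x=H^{-1}Q_x$, $D_y=H^{-1}Q_y$ with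 $Q_x=\sum_\kappa R_\kappa^TQ_{x,\kappa}R_\kappa$, $Q_y=\sum_\kappa R_\kappa^TQ_{y,\kappa}R_\kappa$. Overbars denote Kronecker products with the $4\times4$ identity: $\overline{D}_x=D_x\otimes I_4$, $\overline{H}=H\otimes I_4$, $\overline{H}_\kappa=H_\kappa\otimes I_4$, $\overline{R}_\kappa=R_\kappa\otimes I_4$, $\overline{P}_\kappa=P_\kappa\otimes I_4$, etc. $\circ$ is the Hadamard (entrywise) product. Local projection: $P_\kappa=I-LL^TH_\kappa$, where the columns of $L$ are the nodal values of an $L^2$-orthonormal basis of the polynomials of total degree at most $p$ on the reference element, $p$ here denoting the degree of the SBP operator (with $H_\kappa$ a degree-$2p$ exact cubature, so $L^TH_\kappa L=I$). $A_\kappa\in\mathbb{R}^{4n_\kappa\times4n_\kappa}$ is a scaling matrix, which may depend on the solution. Flux matrices: $F_x(u_h)$ is the $n\times n$ block matrix whose $(i,j)$ block is $2\,\mathrm{diag}[\mathcal{F}^\star_x(u_i,u_j)]\in\mathbb{R}^{4\times4}$; $F_y(u_h)$ is defined similarly. $\mathcal{F}^\star_x$ is a two-point entropy-conservative flux in the sense of Tadmor: it is consistent, $\mathcal{F}^\star_x(u,u)=\mathcal{F}_x(u)$; symmetric, $\mathcal{F}^\star_x(u_i,u_j)=\mathcal{F}^\star_x(u_j,u_i)$; and satisfies $(\mathcal{W}(u_i)-\mathcal{W}(u_j))^T\mathcal{F}^\star_x(u_i,u_j)=\psi_x(u_i)-\psi_x(u_j)$. The same holds for $\mathcal{F}^\star_y$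 with $\psi_y$. *)

theory Defs
  imports "HOL-Analysis.Analysis" "Jordan_Normal_Form.Gauss_Jordan_Elimination"
begin

unbundle no vec_syntax and no inner_syntax
hide_const (open) Finite_Cartesian_Product.vec Finite_Cartesian_Product.mat
hide_type (open) Finite_Cartesian_Product.vec

section \<open>Matrix notions missing from the library\<close>

definition ones_vec :: "nat \<Rightarrow> real vec" where
  "ones_vec n = Matrix.vec n (\<lambda>_. 1)"

definition hadamard :: "real mat \<Rightarrow> real mat \<Rightarrow> real mat" where
  "hadamard A B = Matrix.mat (dim_row A) (dim_col A) (\<lambda>(i, j). A $$ (i, j) * B $$ (i, j))"

definition kronecker :: "real mat \<Rightarrow> real mat \<Rightarrow> real mat" where
  "kronecker A B = Matrix.mat (dim_row A * dim_row B) (dim_col A * dim_col B)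
     (\<lambda>(r, c). A $$ (r div dim_row B, c div dim_col B) * B $$ (r mod dim_row B, c mod dim_col B))"

abbreviation overbar :: "real mat \<Rightarrow> real mat" where
  "overbar A \<equiv> kronecker A (1\<^sub>m 4)"

definition mat_sum :: "nat \<Rightarrow> nat \<Rightarrow> (nat \<Rightarrow> real mat) \<Rightarrow> nat set \<Rightarrow> real mat" where
  "mat_sum nr nc M I = Matrix.mat nr nc (\<lambda>(i, j). \<Sum>k\<in>I. M k $$ (i, j))"

text \<open>\<^const>\<open>mat_inverse\<close> is \<^const>\<open>None\<close> on singular matrices; on a valid mesh every matrix inverted below is regular
  (see \<open>global_norm_diagonal\<close> and \<open>global_norm_positive\<close>).\<close>

definition inv_mat :: "real mat \<Rightarrow> real mat" where
  "inv_mat A = the (mat_inverse A)"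

definition sym_pos_semidef :: "real mat \<Rightarrow> bool" where
  "sym_pos_semidef A \<longleftrightarrow> square_mat A \<and> transpose_mat A = A \<and>
     (\<forall>x \<in> carrier_vec (dim_row A). 0 \<le> x \<bullet> (A *\<^sub>v x))"

section \<open>The Euler equations\<close>

text \<open>A state is the vector of conservative variables $[\rho, \rho u, \rho v, e]$.\<close>

definition gam :: real where "gam = 14 / 10"

definition rho :: "real vec \<Rightarrow> real" where "rho U = U $ 0"
definition velx :: "real vec \<Rightarrow> real" where "velx U = U $ 1 / U $ 0"
definition vely :: "real vec \<Rightarrow> real" where "vely U = U $ 2 / U $ 0"
definition energy :: "real vec \<Rightarrow> real" where "energy U = U $ 3"

definition pressure :: "real vec \<Rightarrow> real" where
  "pressure U = (gam - 1) * (energy U - rho U / 2 * ((velx U)\<^sup>2 + (vely U)\<^sup>2))"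

definition admissible :: "real vec \<Rightarrow> bool" where
  "admissible U \<longleftrightarrow> U \<in> carrier_vec 4 \<and> 0 < rho U \<and> 0 < pressure U"

definition euler_flux_x :: "real vec \<Rightarrow> real vec" where
  "euler_flux_x U = vec_of_list
     [rho U * velx U, rho U * (velx U)\<^sup>2 + pressure U,
      rho U * velx U * vely U, (energy U + pressure U) * velx U]"

definition euler_flux_y :: "real vec \<Rightarrow> real vec" where
  "euler_flux_y U = vec_of_list
     [rho U * vely U, rho U * vely U * velx U,
      rho U * (vely U)\<^sup>2 + pressure U, (energy U + pressure U) * vely U]"

definition phys_entropy :: "real vec \<Rightarrow> real" where
  "phys_entropy U = ln (pressure U / rho U powr gam)"

definition entropy :: "real vec \<Rightarrow> real" where
  "entropy U = - (rho U * phys_entropy U) / (gam - 1)"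

definition entropy_vars :: "real vec \<Rightarrow> real vec" where
  "entropy_vars U = vec_of_list
     [(gam - phys_entropy U) / (gam - 1)
        - 1 / 2 * (rho U / pressure U) * ((velx U)\<^sup>2 + (vely U)\<^sup>2),
      rho U * velx U / pressure U,
      rho U * vely U / pressure U,
      - (rho U / pressure U)]"

definition potential_x :: "real vec \<Rightarrow> real" where "potential_x U = rho U * velx U"
definition potential_y :: "real vec \<Rightarrow> real" where "potential_y U = rho U * vely U"

definition entropy_conservative_flux ::
  "(real vec \<Rightarrow> real vec) \<Rightarrow> (real vec \<Rightarrow> real) \<Rightarrow> (real vec \<Rightarrow> real vec \<Rightarrow> real vec) \<Rightarrow> bool" where
  "entropy_conservative_flux f \<psi> F \<longleftrightarrow>
     (\<forall>U V. admissible U \<longrightarrow> admissible V \<longrightarrow>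
        F U V \<in> carrier_vec 4 \<and> F U U = f U \<and> F U V = F V U \<and>
        (entropy_vars U - entropy_vars V) \<bullet> F U V = \<psi> U - \<psi> V)"

section \<open>The mesh and the summation-by-parts operators\<close>

text \<open>Elements are indexed by $\kappa < K$ and carry local nodes $i < n_\kappa$; \<open>gidx \<kappa> i\<close> is the
  global index of a local node, \<open>emap \<kappa>\<close> maps the reference element to the physical one and
  \<open>demap \<kappa> x\<close> is its derivative at \<open>x\<close>. The polynomials \<open>bas j\<close>, $j <$ \<open>nbas\<close>, are the orthonormal
  basis that defines the local projection.\<close>

record discretization =
  nel :: nat
  nglob :: nat
  nloc :: "nat \<Rightarrow> nat"
  gidx :: "nat \<Rightarrow> nat \<Rightarrow> nat"
  ref_elem :: "(real \<times> real) set"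
  ref_node :: "nat \<Rightarrow> nat \<Rightarrow> real \<times> real"
  weight :: "nat \<Rightarrow> nat \<Rightarrow> real"
  emap :: "nat \<Rightarrow> real \<times> real \<Rightarrow> real \<times> real"
  demap :: "nat \<Rightarrow> real \<times> real \<Rightarrow> real \<times> real \<Rightarrow> real \<times> real"
  sbp_degree :: nat
  nbas :: nat
  bas :: "nat \<Rightarrow> real \<times> real \<Rightarrow> real"
  Sx :: "nat \<Rightarrow> real mat"
  Ex :: "nat \<Rightarrow> real mat"
  Sy :: "nat \<Rightarrow> real mat"
  Ey :: "nat \<Rightarrow> real mat"

definition jac_det :: "discretization \<Rightarrow> nat \<Rightarrow> real \<times> real \<Rightarrow> real" where
  "jac_det M \<kappa> x =
     fst (demap M \<kappa> x (1, 0)) * snd (demap M \<kappa> x (0, 1))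
     - fst (demap M \<kappa> x (0, 1)) * snd (demap M \<kappa> x (1, 0))"

definition lattice :: "(real \<times> real) set" where
  "lattice = {(of_int a, of_int b) | (a :: int) (b :: int). True}"

definition phys_elem :: "discretization \<Rightarrow> nat \<Rightarrow> real \<times> real \<Rightarrow> (real \<times> real) set" where
  "phys_elem M \<kappa> z = (\<lambda>x. emap M \<kappa> x + z) ` ref_elem M"

text \<open>The periodic domain $[0,1]^2$ is the torus $\mathbb{R}^2/\mathbb{Z}^2$: the elements tile it when
  their integer translates tile the plane, and two nodes coincide when their physical positions
  differ by a lattice vector.\<close>

definition periodic_mesh :: "discretization \<Rightarrow> bool" where
  "periodic_mesh M \<longleftrightarrow>
     compact (ref_elem M) \<and> interior (ref_elem M) \<noteq> {} \<and>
     (\<forall>\<kappa> < nel M. inj_on (emap M \<kappa>) (ref_elem M) \<and>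
        (\<forall>x \<in> ref_elem M. (emap M \<kappa> has_derivative demap M \<kappa> x) (at x within ref_elem M) \<and>
           0 < jac_det M \<kappa> x)) \<and>
     (\<Union>\<kappa> \<in> {..<nel M}. \<Union>z \<in> lattice. phys_elem M \<kappa> z) = UNIV \<and>
     (\<forall>\<kappa> < nel M. \<forall>\<kappa>' < nel M. \<forall>z \<in> lattice. \<forall>z' \<in> lattice. (\<kappa>, z) \<noteq> (\<kappa>', z') \<longrightarrow>
        interior (phys_elem M \<kappa> z) \<inter> interior (phys_elem M \<kappa>' z') = {}) \<and>
     (\<forall>\<kappa> < nel M. ref_node M \<kappa> ` {..<nloc M \<kappa>} \<subseteq> ref_elem M \<and>
        inj_on (ref_node M \<kappa>) {..<nloc M \<kappa>}) \<and>
     (\<Union>\<kappa> \<in> {..<nel M}. gidx M \<kappa> ` {..<nloc M \<kappa>}) = {..<nglob M} \<and>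
     (\<forall>\<kappa> < nel M. \<forall>\<kappa>' < nel M. \<forall>i < nloc M \<kappa>. \<forall>i' < nloc M \<kappa>'.
        gidx M \<kappa> i = gidx M \<kappa>' i' \<longleftrightarrow>
          emap M \<kappa> (ref_node M \<kappa> i) - emap M \<kappa>' (ref_node M \<kappa>' i') \<in> lattice)"

text \<open>Polynomials in two variables of total degree at most \<open>d\<close>, as functions on the plane.\<close>

definition poly2 :: "nat \<Rightarrow> (real \<times> real \<Rightarrow> real) set" where
  "poly2 d = {f. \<exists>c. f = (\<lambda>(x, y). \<Sum>i\<le>d. \<Sum>j\<le>d - i. c i j * x ^ i * y ^ j)}"

definition cubature_rules :: "discretization \<Rightarrow> bool" where
  "cubature_rules M \<longleftrightarrow>
     (\<forall>\<kappa> < nel M. (\<forall>i < nloc M \<kappa>. 0 < weight M \<kappa> i) \<and>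
        (\<forall>f \<in> poly2 (2 * sbp_degree M).
           (\<Sum>i<nloc M \<kappa>. weight M \<kappa> i * f (ref_node M \<kappa> i)) = (LINT x:ref_elem M|lborel. f x)))"

definition orthonormal_poly_basis :: "discretization \<Rightarrow> bool" where
  "orthonormal_poly_basis M \<longleftrightarrow>
     (\<forall>j < nbas M. bas M j \<in> poly2 (sbp_degree M)) \<and>
     (\<forall>j < nbas M. \<forall>k < nbas M.
        (LINT x:ref_elem M|lborel. bas M j x * bas M k x) = (if j = k then 1 else 0)) \<and>
     (\<forall>f \<in> poly2 (sbp_degree M). \<exists>c. f = (\<lambda>x. \<Sum>j<nbas M. c j * bas M j x))"

definition restr :: "discretization \<Rightarrow> nat \<Rightarrow> real mat" where
  "restr M \<kappa> = Matrix.mat (nloc M \<kappa>) (nglob M) (\<lambda>(i, j). if j = gidx M \<kappa> i then 1 else 0)"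

definition assemble :: "discretization \<Rightarrow> (nat \<Rightarrow> real mat) \<Rightarrow> real mat" where
  "assemble M X = mat_sum (nglob M) (nglob M)
     (\<lambda>\<kappa>. transpose_mat (restr M \<kappa>) * X \<kappa> * restr M \<kappa>) {..<nel M}"

definition elem_norm :: "discretization \<Rightarrow> nat \<Rightarrow> real mat" where
  "elem_norm M \<kappa> = mat_diag (nloc M \<kappa>) (weight M \<kappa>)"

definition jac_mat :: "discretization \<Rightarrow> nat \<Rightarrow> real mat" where
  "jac_mat M \<kappa> = mat_diag (nloc M \<kappa>) (\<lambda>i. jac_det M \<kappa> (ref_node M \<kappa> i))"

definition global_norm :: "discretization \<Rightarrow> real mat" where
  "global_norm M = assemble M (\<lambda>\<kappa>. jac_mat M \<kappa> * elem_norm M \<kappa>)"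

definition basis_mat :: "discretization \<Rightarrow> nat \<Rightarrow> real mat" where
  "basis_mat M \<kappa> = Matrix.mat (nloc M \<kappa>) (nbas M) (\<lambda>(i, j). bas M j (ref_node M \<kappa> i))"

definition local_proj :: "discretization \<Rightarrow> nat \<Rightarrow> real mat" where
  "local_proj M \<kappa> =
     1\<^sub>m (nloc M \<kappa>) - basis_mat M \<kappa> * transpose_mat (basis_mat M \<kappa>) * elem_norm M \<kappa>"

definition elem_Qx :: "discretization \<Rightarrow> nat \<Rightarrow> real mat" where
  "elem_Qx M \<kappa> = Sx M \<kappa> + (1 / 2) \<cdot>\<^sub>m Ex M \<kappa>"

definition elem_Qy :: "discretization \<Rightarrow> nat \<Rightarrow> real mat" where
  "elem_Qy M \<kappa> = Sy M \<kappa> + (1 / 2) \<cdot>\<^sub>m Ey M \<kappa>"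

definition sbp_operators ::
  "discretization \<Rightarrow> (nat \<Rightarrow> real mat) \<Rightarrow> (nat \<Rightarrow> real mat) \<Rightarrow> (nat \<Rightarrow> real mat) \<Rightarrow> bool" where
  "sbp_operators M S E Q \<longleftrightarrow>
     (\<forall>\<kappa> < nel M.
        S \<kappa> \<in> carrier_mat (nloc M \<kappa>) (nloc M \<kappa>) \<and>
        E \<kappa> \<in> carrier_mat (nloc M \<kappa>) (nloc M \<kappa>) \<and>
        transpose_mat (S \<kappa>) = - S \<kappa> \<and> transpose_mat (E \<kappa>) = E \<kappa> \<and>
        Q \<kappa> *\<^sub>v ones_vec (nloc M \<kappa>) = 0\<^sub>v (nloc M \<kappa>)) \<and>
     assemble M E = 0\<^sub>m (nglob M) (nglob M)"

definition sbp_discretization :: "discretization \<Rightarrow> bool" where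
  "sbp_discretization M \<longleftrightarrow>
     periodic_mesh M \<and> cubature_rules M \<and> orthonormal_poly_basis M \<and>
     sbp_operators M (Sx M) (Ex M) (elem_Qx M) \<and> sbp_operators M (Sy M) (Ey M) (elem_Qy M)"

definition global_Dx :: "discretization \<Rightarrow> real mat" where
  "global_Dx M = inv_mat (global_norm M) * assemble M (elem_Qx M)"

definition global_Dy :: "discretization \<Rightarrow> real mat" where
  "global_Dy M = inv_mat (global_norm M) * assemble M (elem_Qy M)"

section \<open>The semi-discretization\<close>

text \<open>Global vectors are stacked node by node: component \<open>c\<close> of the state at node \<open>i\<close> has index
  \<open>4 * i + c\<close>, which matches \<^const>\<open>overbar\<close>.\<close>

definition node_state :: "real vec \<Rightarrow> nat \<Rightarrow> real vec" where
  "node_state u i = Matrix.vec 4 (\<lambda>c. u $ (4 * i + c))"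

definition entropy_vars_h :: "nat \<Rightarrow> real vec \<Rightarrow> real vec" where
  "entropy_vars_h n u = Matrix.vec (4 * n) (\<lambda>r. entropy_vars (node_state u (r div 4)) $ (r mod 4))"

definition entropy_h :: "nat \<Rightarrow> real vec \<Rightarrow> real vec" where
  "entropy_h n u = Matrix.vec n (\<lambda>i. entropy (node_state u i))"

definition flux_block :: "(real vec \<Rightarrow> real vec \<Rightarrow> real vec) \<Rightarrow> real vec \<Rightarrow> nat \<Rightarrow> nat \<Rightarrow> real mat" where
  "flux_block F u i j = 2 \<cdot>\<^sub>m mat_diag 4 (\<lambda>c. F (node_state u i) (node_state u j) $ c)"

definition flux_mat :: "nat \<Rightarrow> (real vec \<Rightarrow> real vec \<Rightarrow> real vec) \<Rightarrow> real vec \<Rightarrow> real mat" where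
  "flux_mat n F u = Matrix.mat (4 * n) (4 * n)
     (\<lambda>(r, c). flux_block F u (r div 4) (c div 4) $$ (r mod 4, c mod 4))"

definition dissipation_mat :: "discretization \<Rightarrow> (nat \<Rightarrow> real mat) \<Rightarrow> real mat" where
  "dissipation_mat M A = mat_sum (4 * nglob M) (4 * nglob M)
     (\<lambda>\<kappa>. transpose_mat (overbar (restr M \<kappa>)) * transpose_mat (overbar (local_proj M \<kappa>))
        * overbar (elem_norm M \<kappa>) * A \<kappa> * overbar (local_proj M \<kappa>) * overbar (restr M \<kappa>))
     {..<nel M}"

definition vec_has_derivative :: "(real \<Rightarrow> real vec) \<Rightarrow> real vec \<Rightarrow> real filter \<Rightarrow> bool" where
  "vec_has_derivative u du F \<longleftrightarrow>
     (\<forall>r < dim_vec du. ((\<lambda>t. u t $ r) has_real_derivative du $ r) F)"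

text \<open>\<open>T\<close> is the time interval; at an endpoint belonging to \<open>T\<close> the derivative is one-sided.\<close>

definition solves_semidiscretization ::
  "discretization \<Rightarrow> (real vec \<Rightarrow> real vec \<Rightarrow> real vec) \<Rightarrow> (real vec \<Rightarrow> real vec \<Rightarrow> real vec)
    \<Rightarrow> (nat \<Rightarrow> real vec \<Rightarrow> real mat) \<Rightarrow> real set \<Rightarrow> (real \<Rightarrow> real vec) \<Rightarrow> bool" where
  "solves_semidiscretization M Fx Fy A T u \<longleftrightarrow>
     (\<forall>t \<in> T. u t \<in> carrier_vec (4 * nglob M) \<and>
        (\<forall>i < nglob M. admissible (node_state (u t) i)) \<and>
        (\<exists>du \<in> carrier_vec (4 * nglob M).
           vec_has_derivative u du (at t within T) \<and>
           du + hadamard (overbar (global_Dx M)) (flux_mat (nglob M) Fx (u t)) *\<^sub>v ones_vec (4 * nglob M)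
              + hadamard (overbar (global_Dy M)) (flux_mat (nglob M) Fy (u t)) *\<^sub>v ones_vec (4 * nglob M)
           = - (inv_mat (overbar (global_norm M)) * dissipation_mat M (\<lambda>\<kappa>. A \<kappa> (u t))
                *\<^sub>v entropy_vars_h (nglob M) (u t))))"

definition total_entropy :: "discretization \<Rightarrow> real vec \<Rightarrow> real" where
  "total_entropy M u = ones_vec (nglob M) \<bullet> (global_norm M *\<^sub>v entropy_h (nglob M) u)"

section \<open>Consistency of the definitions\<close>

lemma entropy_chain_rule:
  fixes r q :: "real \<Rightarrow> real"
  assumes "0 < r x" "0 < q x"
    and r: "(r has_real_derivative dr) (at x)" and q: "(q has_real_derivative dq) (at x)"
  shows "((\<lambda>x. - (r x * ln (q x / r x powr gam)) / (gam - 1)) has_real_derivative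
    - (dr * ln (q x / r x powr gam) + r x * dq / q x - gam * dr) / (gam - 1)) (at x)"
  using assms powr_mult_base[of "r x" "2 / 5"]
  by (auto intro!: derivative_eq_intros simp: gam_def field_simps powr_diff)

lemma pressure_rewrite:
  "pressure U = 2 / 5 * (U $ 3 - ((U $ 1)\<^sup>2 + (U $ 2)\<^sup>2) / (2 * U $ 0))"
  by (cases "U $ 0 = 0")
    (simp_all add: pressure_def gam_def rho_def velx_def vely_def energy_def field_simps power2_eq_square)

lemma entropy_vars_gradient:
  assumes "admissible U" "k < 4"
  shows "((\<lambda>x. entropy (update_vec U k x)) has_real_derivative entropy_vars U $ k) (at (U $ k))"
proof -
  have U: "dim_vec U = 4" "0 < U $ 0" and P: "0 < pressure U"
    using assms by (auto simp: admissible_def rho_def)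
  have dims: "i < 4 \<Longrightarrow> update_vec U k x $ i = (if i = k then x else U $ i)" for i x
    using U by (simp add: update_vec_def)
  have chain: "((\<lambda>x. entropy (update_vec U k x)) has_real_derivative
      - (dr * phys_entropy U + rho U * dq / pressure U - gam * dr) / (gam - 1)) (at (U $ k))"
    if "((\<lambda>x. rho (update_vec U k x)) has_real_derivative dr) (at (U $ k))"
       "((\<lambda>x. pressure (update_vec U k x)) has_real_derivative dq) (at (U $ k))" for dr dq
  proof -
    have "update_vec U k (U $ k) = U"
      using U by (intro eq_vecI) (auto simp: update_vec_def)
    then show ?thesis
      using entropy_chain_rule[OF _ _ that] U P
      by (simp add: entropy_def phys_entropy_def rho_def)
  qed
  have ev: "entropy_vars U $ 0 = (gam - phys_entropy U) / (gam - 1)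
        - 1 / 2 * (rho U / pressure U) * ((velx U)\<^sup>2 + (vely U)\<^sup>2)"
    "entropy_vars U $ Suc 0 = rho U * velx U / pressure U"
    "entropy_vars U $ 2 = rho U * vely U / pressure U"
    "entropy_vars U $ 3 = - (rho U / pressure U)"
    by (simp_all add: entropy_vars_def numeral_2_eq_2 numeral_3_eq_3)
  consider "k = 0" | "k = 1" | "k = 2" | "k = 3" using assms(2) by linarith
  then show ?thesis
  proof cases
    case 1
    have "((\<lambda>x. rho (update_vec U k x)) has_real_derivative 1) (at (U $ k))"
      by (simp add: rho_def dims[unfolded 1] 1)
    moreover have "((\<lambda>x. pressure (update_vec U k x)) has_real_derivative
        (1 / 5) * ((velx U)\<^sup>2 + (vely U)\<^sup>2)) (at (U $ k))"
      unfolding pressure_rewrite using U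
      by (auto intro!: derivative_eq_intros simp: dims[unfolded 1] 1 velx_def vely_def field_simps power2_eq_square)
    ultimately show ?thesis
      by (rule DERIV_cong[OF chain]) (use P in \<open>simp add: ev 1 gam_def velx_def vely_def rho_def field_simps\<close>)
  next
    case 2
    have "((\<lambda>x. rho (update_vec U k x)) has_real_derivative 0) (at (U $ k))"
      by (simp add: rho_def dims[unfolded 2] 2)
    moreover have "((\<lambda>x. pressure (update_vec U k x)) has_real_derivative
        - (2 / 5) * velx U) (at (U $ k))"
      unfolding pressure_rewrite using U
      by (auto intro!: derivative_eq_intros simp: dims[unfolded 2] 2 velx_def field_simps power2_eq_square)
    ultimately show ?thesis
      by (rule DERIV_cong[OF chain]) (use P in \<open>simp add: ev 2 gam_def velx_def vely_def rho_def field_simps\<close>)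
  next
    case 3
    have "((\<lambda>x. rho (update_vec U k x)) has_real_derivative 0) (at (U $ k))"
      by (simp add: rho_def dims[unfolded 3] 3)
    moreover have "((\<lambda>x. pressure (update_vec U k x)) has_real_derivative
        - (2 / 5) * vely U) (at (U $ k))"
      unfolding pressure_rewrite using U
      by (auto intro!: derivative_eq_intros simp: dims[unfolded 3] 3 vely_def field_simps power2_eq_square)
    ultimately show ?thesis
      by (rule DERIV_cong[OF chain]) (use P in \<open>simp add: ev 3 gam_def velx_def vely_def rho_def field_simps\<close>)
  next
    case 4
    have "((\<lambda>x. rho (update_vec U k x)) has_real_derivative 0) (at (U $ k))"
      by (simp add: rho_def dims[unfolded 4] 4)
    moreover have "((\<lambda>x. pressure (update_vec U k x)) has_real_derivative 2 / 5) (at (U $ k))"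
      unfolding pressure_rewrite using U
      by (auto intro!: derivative_eq_intros simp: dims[unfolded 4] 4)
    ultimately show ?thesis
      by (rule DERIV_cong[OF chain]) (use P in \<open>simp add: ev 4 gam_def velx_def vely_def rho_def field_simps\<close>)
  qed
qed

lemma assemble_dim: "assemble M X \<in> carrier_mat (nglob M) (nglob M)"
  by (simp add: assemble_def mat_sum_def)

lemma global_norm_entry:
  assumes "i < nglob M" "j < nglob M"
  shows "global_norm M $$ (i, j) = (\<Sum>\<kappa><nel M. \<Sum>l<nloc M \<kappa>.
    if gidx M \<kappa> l = i \<and> gidx M \<kappa> l = j then jac_det M \<kappa> (ref_node M \<kappa> l) * weight M \<kappa> l else 0)"
proof -
  have "(transpose_mat (restr M \<kappa>) * (jac_mat M \<kappa> * elem_norm M \<kappa>) * restr M \<kappa>) $$ (i, j)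
    = (\<Sum>l<nloc M \<kappa>.
    if gidx M \<kappa> l = i \<and> gidx M \<kappa> l = j then jac_det M \<kappa> (ref_node M \<kappa> l) * weight M \<kappa> l else 0)" for \<kappa>
  proof -
    have R: "transpose_mat (restr M \<kappa>) \<in> carrier_mat (nglob M) (nloc M \<kappa>)"
      by (simp add: restr_def)
    show ?thesis
      unfolding jac_mat_def elem_norm_def mat_diag_diag mat_diag_mult_right[OF R]
      using assms by (auto simp: restr_def scalar_prod_def lessThan_atLeast0 intro!: sum.cong)
  qed
  then show ?thesis using assms
    by (simp add: global_norm_def assemble_def mat_sum_def)
qed

lemma global_norm_diagonal: "diagonal_mat (global_norm M)"
proof -
  have "global_norm M \<in> carrier_mat (nglob M) (nglob M)"
    by (simp add: global_norm_def assemble_dim)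
  then show ?thesis
    unfolding diagonal_mat_def by (auto simp: global_norm_entry intro!: sum.neutral)
qed

lemma global_norm_positive:
  assumes "periodic_mesh M" "cubature_rules M" "i < nglob M"
  shows "0 < global_norm M $$ (i, i)"
proof -
  have pos: "0 < jac_det M \<kappa> (ref_node M \<kappa> l) * weight M \<kappa> l" if "\<kappa> < nel M" "l < nloc M \<kappa>" for \<kappa> l
    using assms(1,2) that unfolding periodic_mesh_def cubature_rules_def
    by (intro mult_pos_pos) (auto simp: image_subset_iff)
  have "i \<in> (\<Union>\<kappa> \<in> {..<nel M}. gidx M \<kappa> ` {..<nloc M \<kappa>})"
    using assms(1,3) unfolding periodic_mesh_def by auto
  then obtain \<kappa> l where kl: "\<kappa> < nel M" "l < nloc M \<kappa>" "gidx M \<kappa> l = i" by auto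
  show ?thesis
    unfolding global_norm_entry[OF assms(3) assms(3)]
  proof (rule sum_pos2[where i = \<kappa>])
    show "0 < (\<Sum>l<nloc M \<kappa>. if gidx M \<kappa> l = i \<and> gidx M \<kappa> l = i
        then jac_det M \<kappa> (ref_node M \<kappa> l) * weight M \<kappa> l else 0)"
      using kl pos by (intro sum_pos2[where i = l]) (auto intro: less_imp_le)
  qed (use kl in \<open>auto intro!: sum_nonneg less_imp_le[OF pos]\<close>)
qed

end

theory Submission
  imports Defs
begin

text \<open>By the chain rule, the total entropy changes at the rate $w_h^T \overline{H}\, du_h/dt$. The norm
  cancels the inverses in the semi-discretization. The assembled $Q_x$ is skew-symmetric, because the
  boundary matrices cancel, and has zero row sums; with Tadmor's condition the flux term is then
  $2 \sum_{ij} Q_{ij} w_i^T F_{ij} = \sum_{ij} Q_{ij} (\psi_i - \psi_j) = 0$. What remains is minus the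
  sum over the elements of the quadratic form of $\overline{H}_\kappa A_\kappa$ at
  $\overline{P}_\kappa \overline{R}_\kappa w_h$.\<close>

section \<open>Stacked indices and Kronecker products with the identity\<close>

text \<open>With \<open>k = 4\<close> this passes from the stacked index of a global vector to the
  pair of node \<open>i\<close> and component \<open>c\<close>.\<close>

lemma sum_nat_blocks:
  fixes f :: "nat \<Rightarrow> 'a::comm_monoid_add"
  shows "(\<Sum>r<k * n. f r) = (\<Sum>i<n. \<Sum>c<k. f (k * i + c))"
proof (induction n)
  case (Suc n)
  have "{..<k * Suc n} = {..<k * n} \<union> {k * n..<k * n + k}"
    by auto
  moreover have "(\<Sum>r = k * n..<k * n + k. f r) = (\<Sum>c<k. f (k * n + c))"
    using sum.shift_bounds_nat_ivl[of f 0 "k * n" k]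
    by (simp add: lessThan_atLeast0 add.commute)
  ultimately show ?case
    using Suc by (simp add: sum.union_disjoint ivl_disj_int)
qed simp

lemma nat_block_less:
  fixes c i k n :: nat
  assumes "i < n" "c < k"
  shows "k * i + c < k * n"
proof -
  have "k * i + c < k * Suc i"
    using assms by simp
  also have "\<dots> \<le> k * n"
    using assms by (intro mult_le_mono) auto
  finally show ?thesis .
qed

lemma scalar_prod_lessThan: "v \<bullet> w = (\<Sum>i<dim_vec w. v $ i * w $ i)"
  by (simp add: scalar_prod_def lessThan_atLeast0)

lemma overbar_carrier:
  "A \<in> carrier_mat m n \<Longrightarrow> overbar A \<in> carrier_mat (4 * m) (4 * n)"
  by (auto simp: kronecker_def)

lemma overbar_index:
  assumes "i < dim_row A" "j < dim_col A" "c < 4" "d < 4"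
  shows "overbar A $$ (4 * i + c, 4 * j + d) = (if c = d then A $$ (i, j) else 0)"
  using assms by (simp add: kronecker_def)

section \<open>Inverses of the diagonal norm matrices\<close>

text \<open>\<open>inv_mat\<close> unwraps an option, so the case \<open>None\<close> has to be
  excluded: there \<open>B\<close> would contradict that \<open>A\<close> is not a unit of the
  matrix ring. In the other case the uniqueness of two-sided inverses decides.\<close>

lemma inv_mat_eqI:
  assumes "A \<in> carrier_mat n n" "B \<in> carrier_mat n n" "A * B = 1\<^sub>m n" "B * A = 1\<^sub>m n"
  shows "inv_mat A = B"
proof (cases "mat_inverse A")
  case None
  then have "A \<notin> Units (ring_mat TYPE(real) n ())"
    by (rule mat_inverse(1)[OF assms(1)])
  then show ?thesis
    using assms unfolding Units_def ring_mat_def by auto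
next
  case (Some C)
  then have C: "A * C = 1\<^sub>m n" "C * A = 1\<^sub>m n" "C \<in> carrier_mat n n"
    using mat_inverse(2)[OF assms(1)] by auto
  have "C = C * (A * B)"
    using C assms by simp
  also have "\<dots> = B"
    using C assms assoc_mult_mat[of C n n A n B n] by simp
  finally show ?thesis
    using Some by (simp add: inv_mat_def)
qed

lemma inv_mat_diag:
  fixes d :: "nat \<Rightarrow> real"
  assumes "\<And>i. i < n \<Longrightarrow> d i \<noteq> 0"
  shows "inv_mat (mat_diag n d) = mat_diag n (\<lambda>i. inverse (d i))"
proof (rule inv_mat_eqI)
  have "mat_diag n (\<lambda>i. d i * inverse (d i)) = 1\<^sub>m n"
    using assms by (intro eq_matI) (auto simp: mat_diag_def)
  then show "mat_diag n d * mat_diag n (\<lambda>i. inverse (d i)) = 1\<^sub>m n"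
    "mat_diag n (\<lambda>i. inverse (d i)) * mat_diag n d = 1\<^sub>m n"
    by (simp_all add: mat_diag_diag mult.commute)
qed auto

lemma overbar_diag: "overbar (mat_diag n d) = mat_diag (4 * n) (\<lambda>r. d (r div 4))"
proof (rule eq_matI)
  fix r c assume "r < dim_row (mat_diag (4 * n) (\<lambda>r. d (r div 4)))"
    "c < dim_col (mat_diag (4 * n) (\<lambda>r. d (r div 4)))"
  then have rc: "r < 4 * n" "c < 4 * n"
    by (auto simp: mat_diag_def)
  \<comment> \<open>A stacked index is determined by its node and component, so the diagonal factor
    and the identity factor together leave only \<open>r = c\<close>.\<close>
  have "r = c \<longleftrightarrow> r div 4 = c div 4 \<and> r mod 4 = c mod 4"
    by (metis div_mod_decomp)
  with rc show "overbar (mat_diag n d) $$ (r, c) = mat_diag (4 * n) (\<lambda>r. d (r div 4)) $$ (r, c)"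
    by (auto simp: kronecker_def mat_diag_def)
qed (auto simp: kronecker_def mat_diag_def)

lemma global_norm_eq_diag:
  "global_norm M = mat_diag (nglob M) (\<lambda>i. global_norm M $$ (i, i))"
proof -
  have "global_norm M \<in> carrier_mat (nglob M) (nglob M)"
    by (simp add: global_norm_def assemble_dim)
  then show ?thesis
    using global_norm_diagonal[of M] by (intro eq_matI) (auto simp: mat_diag_def diagonal_mat_def)
qed

lemma inv_global_norm:
  assumes "periodic_mesh M" "cubature_rules M"
  shows "inv_mat (global_norm M) = mat_diag (nglob M) (\<lambda>i. inverse (global_norm M $$ (i, i)))"
  \<comment> \<open>The right-hand side of \<open>global_norm_eq_diag\<close> mentions
    \<open>global_norm M\<close> again, hence a single \<open>subst\<close> instead of a simp
    rule.\<close>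
  by (subst global_norm_eq_diag, rule inv_mat_diag) (use global_norm_positive[OF assms] in force)

lemma inv_overbar_global_norm:
  assumes "periodic_mesh M" "cubature_rules M"
  shows "inv_mat (overbar (global_norm M))
    = mat_diag (4 * nglob M) (\<lambda>r. inverse (global_norm M $$ (r div 4, r div 4)))"
proof (subst global_norm_eq_diag, subst overbar_diag, rule inv_mat_diag)
  fix r assume "r < 4 * nglob M"
  then have "r div 4 < nglob M" by auto
  then show "global_norm M $$ (r div 4, r div 4) \<noteq> 0"
    using global_norm_positive[OF assms] by force
qed

section \<open>Flux terms and assembled summation-by-parts operators\<close>

text \<open>The identity factor of \<open>overbar\<close> and the diagonal blocks of
  \<open>flux_mat\<close> both decouple the components, so each row sum runs over nodes only. The
  factor 2 is the one in \<open>flux_block\<close>.\<close>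

lemma hadamard_flux_index:
  assumes D: "D \<in> carrier_mat n n" and i: "i < n" and c: "c < 4"
  shows "(hadamard (overbar D) (flux_mat n F u) *\<^sub>v ones_vec (4 * n)) $ (4 * i + c)
    = 2 * (\<Sum>j<n. D $$ (i, j) * F (node_state u i) (node_state u j) $ c)"
proof -
  have entry: "hadamard (overbar D) (flux_mat n F u) $$ (4 * i + c, 4 * j + d)
      = (if c = d then 2 * (D $$ (i, j) * F (node_state u i) (node_state u j) $ c) else 0)"
    if "j < n" "d < 4" for j d
    using that assms overbar_carrier[OF D] nat_block_less[of i n c 4] nat_block_less[of j n d 4]
    by (auto simp: hadamard_def overbar_index flux_mat_def flux_block_def mat_diag_def)
  have "(hadamard (overbar D) (flux_mat n F u) *\<^sub>v ones_vec (4 * n)) $ (4 * i + c)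
      = (\<Sum>r<4 * n. hadamard (overbar D) (flux_mat n F u) $$ (4 * i + c, r))"
    using overbar_carrier[OF D] nat_block_less[of i n c 4] i c
    by (simp add: scalar_prod_lessThan ones_vec_def hadamard_def)
  also have "\<dots> = (\<Sum>j<n. \<Sum>d<4. if c = d then 2 * (D $$ (i, j) * F (node_state u i) (node_state u j) $ c) else 0)"
    unfolding sum_nat_blocks by (intro sum.cong) (auto simp: entry)
  finally show ?thesis
    using c by (simp add: sum_distrib_left)
qed

text \<open>The rows of \<open>restr\<close> are zero-one vectors, so the congruence merely adds
  each local entry at the global position of its two nodes.\<close>

lemma assemble_index:
  assumes "i < nglob M" "j < nglob M" "\<forall>\<kappa><nel M. X \<kappa> \<in> carrier_mat (nloc M \<kappa>) (nloc M \<kappa>)"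
  shows "assemble M X $$ (i, j) = (\<Sum>\<kappa><nel M. \<Sum>k<nloc M \<kappa>. \<Sum>l<nloc M \<kappa>.
    if gidx M \<kappa> k = i \<and> gidx M \<kappa> l = j then X \<kappa> $$ (k, l) else 0)"
proof -
  have "(transpose_mat (restr M \<kappa>) * X \<kappa> * restr M \<kappa>) $$ (i, j)
    = (\<Sum>k<nloc M \<kappa>. \<Sum>l<nloc M \<kappa>. if gidx M \<kappa> k = i \<and> gidx M \<kappa> l = j then X \<kappa> $$ (k, l) else 0)"
    if "\<kappa> < nel M" for \<kappa>
  proof -
    have X: "X \<kappa> \<in> carrier_mat (nloc M \<kappa>) (nloc M \<kappa>)"
      using assms(3) that by blast
    have "(transpose_mat (restr M \<kappa>) * X \<kappa> * restr M \<kappa>) $$ (i, j)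
      = (\<Sum>l<nloc M \<kappa>. \<Sum>k<nloc M \<kappa>. if gidx M \<kappa> k = i \<and> gidx M \<kappa> l = j then X \<kappa> $$ (k, l) else 0)"
      using X assms(1,2)
      by (auto simp: restr_def scalar_prod_lessThan sum_distrib_right intro!: sum.cong)
    then show ?thesis
      by (subst sum.swap)
  qed
  then show ?thesis using assms(1,2)
    by (simp add: assemble_def mat_sum_def)
qed

lemma gidx_less:
  assumes "periodic_mesh M" "\<kappa> < nel M" "l < nloc M \<kappa>"
  shows "gidx M \<kappa> l < nglob M"
proof -
  have "gidx M \<kappa> l \<in> (\<Union>\<kappa> \<in> {..<nel M}. gidx M \<kappa> ` {..<nloc M \<kappa>})"
    using assms(2,3) by auto
  also have "\<dots> = {..<nglob M}"
    using assms(1) unfolding periodic_mesh_def by blast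
  finally show ?thesis
    by simp
qed

text \<open>The hypothesis on \<open>E\<close> concerns the assembled matrix, not each element, so
  the comparison of \<open>Q\<close> with \<open>S\<close> is made after assembly. There the
  boundary part vanishes, and skew-symmetry of each \<open>S \<kappa>\<close> survives the
  scattering to global nodes.\<close>

lemma assemble_sbp_skew:
  assumes sbp: "sbp_operators M S E Q" and Q: "\<And>\<kappa>. \<kappa> < nel M \<Longrightarrow> Q \<kappa> = S \<kappa> + (1 / 2) \<cdot>\<^sub>m E \<kappa>"
    and ij: "i < nglob M" "j < nglob M"
  shows "assemble M Q $$ (i, j) = - assemble M Q $$ (j, i)"
proof -
  have S: "\<forall>\<kappa><nel M. S \<kappa> \<in> carrier_mat (nloc M \<kappa>) (nloc M \<kappa>)"
      "\<forall>\<kappa><nel M. E \<kappa> \<in> carrier_mat (nloc M \<kappa>) (nloc M \<kappa>)"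
      "\<forall>\<kappa><nel M. transpose_mat (S \<kappa>) = - S \<kappa>"
    using sbp unfolding sbp_operators_def by auto
  have QS: "assemble M Q $$ (i, j) = assemble M S $$ (i, j)" if ij: "i < nglob M" "j < nglob M" for i j
  proof -
    have "\<forall>\<kappa><nel M. Q \<kappa> \<in> carrier_mat (nloc M \<kappa>) (nloc M \<kappa>)"
      using Q S by auto
    note eqs = assemble_index[OF ij this] assemble_index[OF ij S(1)] assemble_index[OF ij S(2)]
    have "assemble M Q $$ (i, j) = assemble M S $$ (i, j) + 1 / 2 * assemble M E $$ (i, j)"
      unfolding eqs sum_distrib_left sum.distrib[symmetric]
      by (intro sum.cong refl) (use S in \<open>auto simp: Q\<close>)
    moreover have "assemble M E = 0\<^sub>m (nglob M) (nglob M)"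
      using sbp by (simp add: sbp_operators_def)
    ultimately show ?thesis
      using ij by simp
  qed
  have skew: "S \<kappa> $$ (k, l) = - S \<kappa> $$ (l, k)" if "\<kappa> < nel M" "k < nloc M \<kappa>" "l < nloc M \<kappa>" for \<kappa> k l
  proof -
    have "transpose_mat (S \<kappa>) $$ (l, k) = (- S \<kappa>) $$ (l, k)"
      using S(3) that by simp
    then show ?thesis
      using S(1) that by auto
  qed
  have "assemble M S $$ (i, j) = (\<Sum>\<kappa><nel M. \<Sum>k<nloc M \<kappa>. \<Sum>l<nloc M \<kappa>.
      - (if gidx M \<kappa> l = j \<and> gidx M \<kappa> k = i then S \<kappa> $$ (l, k) else 0))"
    unfolding assemble_index[OF ij S(1)]
  proof (intro sum.cong refl)
    fix \<kappa> k l assume "\<kappa> \<in> {..<nel M}" "k \<in> {..<nloc M \<kappa>}" "l \<in> {..<nloc M \<kappa>}"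
    then show "(if gidx M \<kappa> k = i \<and> gidx M \<kappa> l = j then S \<kappa> $$ (k, l) else 0)
        = - (if gidx M \<kappa> l = j \<and> gidx M \<kappa> k = i then S \<kappa> $$ (l, k) else 0)"
      using skew[of \<kappa> k l] by simp
  qed
  \<comment> \<open>Exchanging the two local sums gives the form of \<open>assemble_index\<close> at
    the transposed position \<open>(j, i)\<close>.\<close>
  also have "\<dots> = (\<Sum>\<kappa><nel M. \<Sum>l<nloc M \<kappa>. \<Sum>k<nloc M \<kappa>.
      - (if gidx M \<kappa> l = j \<and> gidx M \<kappa> k = i then S \<kappa> $$ (l, k) else 0))"
    by (intro sum.cong refl sum.swap)
  also have "\<dots> = - assemble M S $$ (j, i)"
    unfolding assemble_index[OF ij(2,1) S(1)] by (simp add: sum_negf)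
  finally show ?thesis
    using QS ij by simp
qed

text \<open>Exactness for constants passes from the elements to the global operator: by
  \<open>gidx_less\<close> every local node has exactly one global index below
  \<open>nglob M\<close>, so summing over \<open>j\<close> restores the full local row sums.\<close>

lemma assemble_sbp_row_sum:
  assumes mesh: "periodic_mesh M" and sbp: "sbp_operators M S E Q"
    and Q: "\<forall>\<kappa><nel M. Q \<kappa> \<in> carrier_mat (nloc M \<kappa>) (nloc M \<kappa>)"
    and i: "i < nglob M"
  shows "(\<Sum>j<nglob M. assemble M Q $$ (i, j)) = 0"
proof -
  have row: "(\<Sum>l<nloc M \<kappa>. Q \<kappa> $$ (k, l)) = 0" if "\<kappa> < nel M" "k < nloc M \<kappa>" for \<kappa> k
  proof -
    have "(Q \<kappa> *\<^sub>v ones_vec (nloc M \<kappa>)) $ k = 0"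
      using sbp that by (simp add: sbp_operators_def)
    then show ?thesis
      using Q that by (auto simp: ones_vec_def scalar_prod_lessThan)
  qed
  have "(\<Sum>j<nglob M. assemble M Q $$ (i, j))
    = (\<Sum>j<nglob M. \<Sum>\<kappa><nel M. \<Sum>k<nloc M \<kappa>. \<Sum>l<nloc M \<kappa>.
        if gidx M \<kappa> k = i \<and> gidx M \<kappa> l = j then Q \<kappa> $$ (k, l) else 0)"
    by (intro sum.cong refl assemble_index[OF i _ Q]) auto
  also have "\<dots> = (\<Sum>\<kappa><nel M. \<Sum>k<nloc M \<kappa>. \<Sum>l<nloc M \<kappa>. \<Sum>j<nglob M.
        if gidx M \<kappa> k = i \<and> gidx M \<kappa> l = j then Q \<kappa> $$ (k, l) else 0)"
    by (simp only: sum.swap[where A = "{..<nglob M}"])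
  also have "\<dots> = (\<Sum>\<kappa><nel M. \<Sum>k<nloc M \<kappa>. \<Sum>l<nloc M \<kappa>. if gidx M \<kappa> k = i then Q \<kappa> $$ (k, l) else 0)"
    by (intro sum.cong refl) (auto simp: gidx_less[OF mesh])
  also have "\<dots> = 0"
  proof -
    have "(\<Sum>l<nloc M \<kappa>. if gidx M \<kappa> k = i then Q \<kappa> $$ (k, l) else 0) = 0"
      if "\<kappa> < nel M" "k < nloc M \<kappa>" for \<kappa> k
      using row[OF that] by (cases "gidx M \<kappa> k = i") auto
    then show ?thesis
      by simp
  qed
  finally show ?thesis .
qed

section \<open>Cancellation of entropy-conservative fluxes\<close>

text \<open>Exchanging \<open>i\<close> and \<open>j\<close> and using skew-symmetry gives
  \<open>?s = X - ?s\<close>, where \<open>X\<close> is the sum of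
  \<open>q i j * (\<psi> i - \<psi> j)\<close>. Both halves of \<open>X\<close> vanish, so
  \<open>?s\<close> is its own negative.\<close>

lemma skew_flux_sum_zero:
  fixes q :: "nat \<Rightarrow> nat \<Rightarrow> real"
  assumes skew: "\<And>i j. i < n \<Longrightarrow> j < n \<Longrightarrow> q i j = - q j i"
    and row: "\<And>i. i < n \<Longrightarrow> (\<Sum>j<n. q i j) = 0"
    and shuffle: "\<And>i j. i < n \<Longrightarrow> j < n \<Longrightarrow> g i j - g j i = \<psi> i - \<psi> j"
  shows "(\<Sum>i<n. \<Sum>j<n. q i j * g i j) = 0"
proof -
  let ?s = "\<Sum>i<n. \<Sum>j<n. q i j * g i j"
  have psi: "(\<Sum>i<n. \<Sum>j<n. q i j * \<psi> i) = 0"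
    by (simp add: sum_distrib_right[symmetric] row)
  \<comment> \<open>Skew-symmetry turns the vanishing row sums into vanishing column sums.\<close>
  have "(\<Sum>i<n. \<Sum>j<n. q i j * \<psi> j) = (\<Sum>i<n. \<Sum>j<n. q j i * \<psi> i)"
    by (rule sum.swap)
  also have "\<dots> = - (\<Sum>i<n. \<Sum>j<n. q i j * \<psi> i)"
    unfolding sum_negf[symmetric]
  proof (intro sum.cong refl)
    fix i j assume "i \<in> {..<n}" "j \<in> {..<n}"
    then show "q j i * \<psi> i = - (q i j * \<psi> i)"
      using skew[of j i] by simp
  qed
  finally have psi': "(\<Sum>i<n. \<Sum>j<n. q i j * \<psi> j) = 0"
    using psi by simp
  have "?s = (\<Sum>i<n. \<Sum>j<n. q j i * g j i)"
    by (rule sum.swap)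
  also have "\<dots> = (\<Sum>i<n. \<Sum>j<n. q i j * \<psi> i - q i j * \<psi> j - q i j * g i j)"
  proof (intro sum.cong refl)
    fix i j assume "i \<in> {..<n}" "j \<in> {..<n}"
    then have eqs: "q j i = - q i j" "g j i = g i j - (\<psi> i - \<psi> j)"
      using skew[of i j] shuffle[of i j] by auto
    show "q j i * g j i = q i j * \<psi> i - q i j * \<psi> j - q i j * g i j"
      unfolding eqs by (simp add: right_diff_distrib)
  qed
  also have "\<dots> = - ?s"
    by (simp add: sum_subtractf psi psi')
  finally show ?thesis
    by simp
qed

text \<open>Symmetry of the flux lets both products share \<open>F U V\<close>, after which Tadmor's
  condition applies. This is the form that \<open>skew_flux_sum_zero\<close> asks for.\<close>

lemma entropy_conservative_flux_shuffle:
  assumes "entropy_conservative_flux f \<psi> F" "admissible U" "admissible V"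
  shows "entropy_vars U \<bullet> F U V - entropy_vars V \<bullet> F V U = \<psi> U - \<psi> V"
proof -
  have F: "F U V \<in> carrier_vec 4" "F V U = F U V"
    "(entropy_vars U - entropy_vars V) \<bullet> F U V = \<psi> U - \<psi> V"
    using assms unfolding entropy_conservative_flux_def by blast+
  have "entropy_vars U \<in> carrier_vec 4" for U
    by (auto simp: entropy_vars_def intro: carrier_vecI)
  then show ?thesis
    using F minus_scalar_prod_distrib[of "entropy_vars U" 4 "entropy_vars V" "F U V"] by simp
qed

section \<open>Sign of the dissipation term\<close>

lemma mat_sum_quadratic_form:
  assumes w: "w \<in> carrier_vec n"
    and X: "\<And>k. k \<in> I \<Longrightarrow> X k \<in> carrier_mat n n"
  shows "w \<bullet> (mat_sum n n X I *\<^sub>v w) = (\<Sum>k\<in>I. w \<bullet> (X k *\<^sub>v w))"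
proof -
  have "w \<bullet> (mat_sum n n X I *\<^sub>v w) = (\<Sum>i<n. \<Sum>j<n. \<Sum>k\<in>I. w $ i * (X k $$ (i, j) * w $ j))"
    using w by (simp add: scalar_prod_lessThan mat_sum_def sum_distrib_left sum_distrib_right)
  also have "\<dots> = (\<Sum>k\<in>I. \<Sum>i<n. \<Sum>j<n. w $ i * (X k $$ (i, j) * w $ j))"
    by (subst sum.swap[of _ I], intro sum.cong refl sum.swap)
  also have "\<dots> = (\<Sum>k\<in>I. w \<bullet> (X k *\<^sub>v w))"
    using w X by (intro sum.cong refl) (auto simp: scalar_prod_lessThan sum_distrib_left dest!: X)
  finally show ?thesis .
qed

text \<open>Moving the two transposed factors across the scalar product turns each summand into the
  quadratic form of a positive semi-definite matrix at the projected restriction of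
  \<open>w\<close>.\<close>

lemma dissipation_nonneg:
  assumes A: "\<And>\<kappa>. \<kappa> < nel M \<Longrightarrow> A \<kappa> \<in> carrier_mat (4 * nloc M \<kappa>) (4 * nloc M \<kappa>)"
    and psd: "\<And>\<kappa>. \<kappa> < nel M \<Longrightarrow> sym_pos_semidef (overbar (elem_norm M \<kappa>) * A \<kappa>)"
    and w: "w \<in> carrier_vec (4 * nglob M)"
  shows "0 \<le> w \<bullet> (dissipation_mat M A *\<^sub>v w)"
proof -
  let ?X = "\<lambda>\<kappa>. transpose_mat (overbar (restr M \<kappa>)) * transpose_mat (overbar (local_proj M \<kappa>))
        * overbar (elem_norm M \<kappa>) * A \<kappa> * overbar (local_proj M \<kappa>) * overbar (restr M \<kappa>)"
  have X: "?X \<kappa> \<in> carrier_mat (4 * nglob M) (4 * nglob M)" and nonneg: "0 \<le> w \<bullet> (?X \<kappa> *\<^sub>v w)"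
    if \<kappa>: "\<kappa> < nel M" for \<kappa>
  proof -
    let ?m = "4 * nloc M \<kappa>" and ?n = "4 * nglob M"
    let ?R = "overbar (restr M \<kappa>)" and ?P = "overbar (local_proj M \<kappa>)" and ?H = "overbar (elem_norm M \<kappa>)"
    let ?y = "?P *\<^sub>v (?R *\<^sub>v w)"
    have "local_proj M \<kappa> \<in> carrier_mat (nloc M \<kappa>) (nloc M \<kappa>)"
      by (rule carrier_matI) (simp_all add: local_proj_def elem_norm_def mat_diag_def basis_mat_def)
    then have R: "?R \<in> carrier_mat ?m ?n" and P: "?P \<in> carrier_mat ?m ?m" and H: "?H \<in> carrier_mat ?m ?m"
      by (auto intro!: overbar_carrier simp: restr_def elem_norm_def)
    have HA: "?H * A \<kappa> \<in> carrier_mat ?m ?m"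
      using H A[OF \<kappa>] by simp
    have y: "?y \<in> carrier_vec ?m"
      using R P w by simp
    show "?X \<kappa> \<in> carrier_mat ?n ?n"
      using R P H A[OF \<kappa>] by auto
    have R': "transpose_mat ?R \<in> carrier_mat ?n ?m" and P': "transpose_mat ?P \<in> carrier_mat ?m ?m"
      using R P by simp_all
    note RP = mult_carrier_mat[OF R' P']
    note RPH = mult_carrier_mat[OF RP H]
    note RPHA = mult_carrier_mat[OF RPH A[OF \<kappa>]]
    note RPHAP = mult_carrier_mat[OF RPHA P]
    let ?z = "(?H * A \<kappa>) *\<^sub>v ?y"
    have z: "?z \<in> carrier_vec ?m"
      using HA y by (rule mult_mat_vec_carrier)
    \<comment> \<open>The product in \<open>dissipation_mat\<close> associates to the left; it is
      regrouped so that \<open>?H * A \<kappa>\<close>, the matrix known to be semi-definite,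
      becomes one factor.\<close>
    have "?X \<kappa> *\<^sub>v w = transpose_mat ?R * transpose_mat ?P * (?H * A \<kappa>) *\<^sub>v ?y"
      unfolding assoc_mult_mat_vec[OF RPHAP R w] assoc_mult_mat_vec[OF RPHA P mult_mat_vec_carrier[OF R w]]
      unfolding assoc_mult_mat[OF RP H A[OF \<kappa>]] ..
    then have "?X \<kappa> *\<^sub>v w = transpose_mat ?R *\<^sub>v (transpose_mat ?P *\<^sub>v ?z)"
      unfolding assoc_mult_mat_vec[OF RP HA y] assoc_mult_mat_vec[OF R' P' z] .
    then have "w \<bullet> (?X \<kappa> *\<^sub>v w) = (transpose_mat ?R *\<^sub>v (transpose_mat ?P *\<^sub>v ?z)) \<bullet> w"
      using comm_scalar_prod[OF w mult_mat_vec_carrier[OF R' mult_mat_vec_carrier[OF P' z]]] by (simp only:)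
    also have "\<dots> = (transpose_mat ?P *\<^sub>v ?z) \<bullet> (?R *\<^sub>v w)"
      by (rule transpose_vec_mult_scalar[OF R w mult_mat_vec_carrier[OF P' z]])
    also have "\<dots> = ?z \<bullet> ?y"
      by (rule transpose_vec_mult_scalar[OF P mult_mat_vec_carrier[OF R w] z])
    also have "\<dots> = ?y \<bullet> ?z"
      by (rule comm_scalar_prod[OF z y])
    also have "\<dots> \<ge> 0"
      using psd[OF \<kappa>] y unfolding sym_pos_semidef_def carrier_matD(1)[OF HA] by blast
    finally show "0 \<le> w \<bullet> (?X \<kappa> *\<^sub>v w)" .
  qed
  show ?thesis
    unfolding dissipation_mat_def using X nonneg
    by (subst mat_sum_quadratic_form[OF w]) (auto intro: sum_nonneg)
qed

section \<open>The chain rule for the entropy along a curve of states\<close>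

lemma entropy_vars_index:
  "entropy_vars U $ 0 = (gam - phys_entropy U) / (gam - 1)
     - 1 / 2 * (rho U / pressure U) * ((velx U)\<^sup>2 + (vely U)\<^sup>2)"
  "entropy_vars U $ Suc 0 = rho U * velx U / pressure U"
  "entropy_vars U $ 2 = rho U * vely U / pressure U"
  "entropy_vars U $ 3 = - (rho U / pressure U)"
  by (simp_all add: entropy_vars_def numeral_2_eq_2 numeral_3_eq_3)

text \<open>The factor \<open>2 / 5\<close> is \<open>gam - 1\<close>, and the coefficients of the
  \<open>d c\<close> are the partial derivatives of the pressure in the conservative
  variables.\<close>

lemma pressure_has_derivative_along:
  assumes U: "\<And>c. c < 4 \<Longrightarrow> ((\<lambda>t. U t $ c) has_real_derivative d c) (at t within T)"
    and pos: "U t $ 0 \<noteq> 0"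
  shows "((\<lambda>t. pressure (U t)) has_real_derivative
    2 / 5 * (d 3 - velx (U t) * d 1 - vely (U t) * d 2
      + 1 / 2 * ((velx (U t))\<^sup>2 + (vely (U t))\<^sup>2) * d 0)) (at t within T)"
proof -
  \<comment> \<open>The calculus is done for four scalar functions, free of vector indices.\<close>
  have gen: "((\<lambda>t. 2 / 5 * (e t - ((a t)\<^sup>2 + (b t)\<^sup>2) / (2 * r t))) has_real_derivative
      2 / 5 * (de - (a t / r t) * da - (b t / r t) * db + 1 / 2 * ((a t / r t)\<^sup>2 + (b t / r t)\<^sup>2) * dr))
      (at t within T)"
    if "(e has_real_derivative de) (at t within T)" "(a has_real_derivative da) (at t within T)"
      "(b has_real_derivative db) (at t within T)" "(r has_real_derivative dr) (at t within T)" "r t \<noteq> 0"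
    for e a b r :: "real \<Rightarrow> real" and de da db dr
    using that by (auto intro!: derivative_eq_intros simp: field_simps power2_eq_square)
  show ?thesis
    unfolding pressure_rewrite velx_def vely_def
    by (rule gen) (use U pos in auto)
qed

text \<open>The counterpart of \<open>entropy_chain_rule\<close> for derivatives within
  \<open>T\<close>, which are one-sided at endpoints of the time interval.\<close>

lemma entropy_chain_rule_within:
  fixes r q :: "real \<Rightarrow> real"
  assumes "0 < r x" "0 < q x"
    and r: "(r has_real_derivative dr) (at x within T)" and q: "(q has_real_derivative dq) (at x within T)"
  shows "((\<lambda>x. - (r x * ln (q x / r x powr gam)) / (gam - 1)) has_real_derivative
    - (dr * ln (q x / r x powr gam) + r x * dq / q x - gam * dr) / (gam - 1)) (at x within T)"
proof -
  have "((\<lambda>x. r x powr gam) has_real_derivative gam * r x powr (gam - 1) * dr) (at x within T)"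
    using DERIV_chain2[OF has_real_derivative_powr[OF assms(1)] r] .
  then have "((\<lambda>x. - (r x * ln (q x / r x powr gam)) / (gam - 1)) has_real_derivative
    - (dr * ln (q x / r x powr gam) + r x * dq / q x
       - r x * (gam * r x powr (gam - 1) * dr) / r x powr gam) / (gam - 1)) (at x within T)"
    using assms by (auto intro!: derivative_eq_intros simp: field_simps gam_def)
  moreover have "r x * (gam * r x powr (gam - 1) * dr) / r x powr gam = gam * dr"
    using assms(1) by (simp add: powr_diff)
  ultimately show ?thesis
    by simp
qed

text \<open>Partial derivatives as in \<open>entropy_vars_gradient\<close> do not by themselves
  yield a derivative along a curve. The entropy depends on the state only through density and
  pressure, so it is differentiated through these two; collecting the coefficient of each
  \<open>d c\<close> gives the entropy variables.\<close>

lemma entropy_has_derivative_along: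
  assumes adm: "admissible (U t)"
    and U: "\<And>c. c < 4 \<Longrightarrow> ((\<lambda>t. U t $ c) has_real_derivative d c) (at t within T)"
  shows "((\<lambda>t. entropy (U t)) has_real_derivative (\<Sum>c<4. entropy_vars (U t) $ c * d c)) (at t within T)"
proof -
  have pos: "0 < U t $ 0" "0 < pressure (U t)"
    using adm by (auto simp: admissible_def rho_def)
  define dp where "dp = 2 / 5 * (d 3 - velx (U t) * d 1 - vely (U t) * d 2
    + 1 / 2 * ((velx (U t))\<^sup>2 + (vely (U t))\<^sup>2) * d 0)"
  have "((\<lambda>t. pressure (U t)) has_real_derivative dp) (at t within T)"
    unfolding dp_def using U pos by (intro pressure_has_derivative_along) auto
  then have "((\<lambda>t. entropy (U t)) has_real_derivative
    - (d 0 * phys_entropy (U t) + rho (U t) * dp / pressure (U t) - gam * d 0) / (gam - 1)) (at t within T)"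
    unfolding entropy_def phys_entropy_def rho_def
    using U pos by (intro entropy_chain_rule_within) auto
  moreover have "- (d 0 * phys_entropy (U t) + rho (U t) * dp / pressure (U t) - gam * d 0) / (gam - 1)
      = (\<Sum>c<4. entropy_vars (U t) $ c * d c)"
  proof -
    have "{..<4} = {0, 1, 2, 3::nat}"
      by auto
    then show ?thesis
      using pos by (simp add: entropy_vars_index gam_def rho_def dp_def field_simps)
  qed
  ultimately show ?thesis
    by simp
qed

section \<open>Testing the semi-discretization with the entropy variables\<close>

text \<open>The weight at node \<open>i\<close> cancels the inverse norm in the derivative operator
  and leaves the assembled \<open>Q\<close>; \<open>skew_flux_sum_zero\<close> then applies to the
  products of nodal entropy variables and two-point fluxes. Operators and flux are generic to serve
  both directions.\<close>

lemma norm_weighted_flux_sum_zero: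
  assumes mesh: "periodic_mesh M" and cub: "cubature_rules M"
    and sbp: "sbp_operators M S E Q" and Q: "\<forall>\<kappa><nel M. Q \<kappa> = S \<kappa> + (1 / 2) \<cdot>\<^sub>m E \<kappa>"
    and flux: "entropy_conservative_flux f \<psi> F"
    and adm: "\<forall>i<nglob M. admissible (node_state v i)"
  shows "(\<Sum>i<nglob M. global_norm M $$ (i, i) * (\<Sum>c<4. entropy_vars (node_state v i) $ c *
    (hadamard (overbar (inv_mat (global_norm M) * assemble M Q)) (flux_mat (nglob M) F v)
      *\<^sub>v ones_vec (4 * nglob M)) $ (4 * i + c))) = 0"
proof -
  let ?n = "nglob M" and ?h = "\<lambda>i. global_norm M $$ (i, i)"
  let ?D = "inv_mat (global_norm M) * assemble M Q"
  let ?g = "\<lambda>i j. entropy_vars (node_state v i) \<bullet> F (node_state v i) (node_state v j)"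
  have h: "?h i > 0" if "i < ?n" for i
    using global_norm_positive[OF mesh cub that] .
  note inv = inv_global_norm[OF mesh cub]
  have D: "?D \<in> carrier_mat ?n ?n"
    unfolding inv by (intro mult_carrier_mat[OF mat_diag_dim] assemble_dim)
  have hD: "?h i * ?D $$ (i, j) = assemble M Q $$ (i, j)" if "i < ?n" "j < ?n" for i j
    unfolding inv mat_diag_mult_left[OF assemble_dim] using that h[of i] by simp
  have F: "dim_vec (F (node_state v i) (node_state v j)) = 4" if "i < ?n" "j < ?n" for i j
  proof -
    have "admissible (node_state v i)" "admissible (node_state v j)"
      using adm that by auto
    then have "F (node_state v i) (node_state v j) \<in> carrier_vec 4"
      using flux unfolding entropy_conservative_flux_def by meson
    then show ?thesis
      by (rule carrier_vecD)
  qed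
  have Qc: "\<forall>\<kappa><nel M. Q \<kappa> \<in> carrier_mat (nloc M \<kappa>) (nloc M \<kappa>)"
    using sbp Q by (auto simp: sbp_operators_def)
  have "?h i * (\<Sum>c<4. entropy_vars (node_state v i) $ c *
      (hadamard (overbar ?D) (flux_mat ?n F v) *\<^sub>v ones_vec (4 * ?n)) $ (4 * i + c))
    = 2 * (\<Sum>j<?n. assemble M Q $$ (i, j) * ?g i j)" if i: "i < ?n" for i
  proof -
    have "?h i * (\<Sum>c<4. entropy_vars (node_state v i) $ c *
        (hadamard (overbar ?D) (flux_mat ?n F v) *\<^sub>v ones_vec (4 * ?n)) $ (4 * i + c))
      = 2 * (\<Sum>c<4. \<Sum>j<?n. (?h i * ?D $$ (i, j))
          * (entropy_vars (node_state v i) $ c * F (node_state v i) (node_state v j) $ c))"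
      \<comment> \<open>Entries of \<open>?D\<close> must stay folded, since \<open>hD\<close>
        rewrites \<open>?h i * ?D $$ (i, j)\<close> as a whole.\<close>
      by (simp add: hadamard_flux_index[OF D i] del: index_mult_mat)
        (simp add: sum_distrib_left mult_ac del: index_mult_mat)
    also have "\<dots> = 2 * (\<Sum>j<?n. assemble M Q $$ (i, j) * ?g i j)"
      by (subst sum.swap) (simp add: hD i F scalar_prod_lessThan sum_distrib_left del: index_mult_mat)
    finally show ?thesis .
  qed
  then have "(\<Sum>i<?n. ?h i * (\<Sum>c<4. entropy_vars (node_state v i) $ c *
      (hadamard (overbar ?D) (flux_mat ?n F v) *\<^sub>v ones_vec (4 * ?n)) $ (4 * i + c)))
    = 2 * (\<Sum>i<?n. \<Sum>j<?n. assemble M Q $$ (i, j) * ?g i j)"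
    by (simp add: sum_distrib_left)
  also have "(\<Sum>i<?n. \<Sum>j<?n. assemble M Q $$ (i, j) * ?g i j) = 0"
  proof (rule skew_flux_sum_zero)
    fix i j assume ij: "i < ?n" "j < ?n"
    show "assemble M Q $$ (i, j) = - assemble M Q $$ (j, i)"
      using assemble_sbp_skew[OF sbp _ ij] Q by blast
    show "?g i j - ?g j i = \<psi> (node_state v i) - \<psi> (node_state v j)"
      using entropy_conservative_flux_shuffle[OF flux] adm ij by blast
  qed (rule assemble_sbp_row_sum[OF mesh sbp Qc])
  finally show ?thesis
    by simp
qed

text \<open>All four components at node \<open>i\<close> are scaled by the inverse of the same
  weight, which the outer factor cancels; the block sums then recombine into one scalar
  product.\<close>

lemma norm_weighted_dissipation:
  assumes mesh: "periodic_mesh M" and cub: "cubature_rules M"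
    and B: "B \<in> carrier_mat (4 * nglob M) (4 * nglob M)"
    and w: "w \<in> carrier_vec (4 * nglob M)"
  shows "(\<Sum>i<nglob M. global_norm M $$ (i, i) * (\<Sum>c<4. w' $ (4 * i + c) *
    (inv_mat (overbar (global_norm M)) * B *\<^sub>v w) $ (4 * i + c))) = w' \<bullet> (B *\<^sub>v w)"
proof -
  let ?n = "nglob M" and ?h = "\<lambda>i. global_norm M $$ (i, i)"
  note inv = inv_overbar_global_norm[OF mesh cub]
  have "?h i * (inv_mat (overbar (global_norm M)) * B *\<^sub>v w) $ (4 * i + c) = (B *\<^sub>v w) $ (4 * i + c)"
    if "i < ?n" "c < 4" for i c
  proof -
    have "(inv_mat (overbar (global_norm M)) * B *\<^sub>v w) $ (4 * i + c)
        = inverse (?h i) * (B *\<^sub>v w) $ (4 * i + c)"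
      unfolding inv mat_diag_mult_left[OF B]
      using that B w nat_block_less[OF that] by (simp add: scalar_prod_lessThan sum_distrib_left mult.assoc)
    then show ?thesis
      using global_norm_positive[OF mesh cub that(1)] by simp
  qed
  then have "(\<Sum>i<?n. ?h i * (\<Sum>c<4. w' $ (4 * i + c) *
      (inv_mat (overbar (global_norm M)) * B *\<^sub>v w) $ (4 * i + c)))
    = (\<Sum>i<?n. \<Sum>c<4. w' $ (4 * i + c) * (B *\<^sub>v w) $ (4 * i + c))"
    unfolding sum_distrib_left by (intro sum.cong refl) (simp add: mult.left_commute)
  also have "\<dots> = w' \<bullet> (B *\<^sub>v w)"
    using B by (simp add: scalar_prod_lessThan sum_nat_blocks)
  finally show ?thesis .
qed

text \<open>As the norm is diagonal, the total entropy is a sum over nodes with weights independent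
  of the state, and can be differentiated node by node.\<close>

lemma total_entropy_eq:
  "total_entropy M v = (\<Sum>i<nglob M. global_norm M $$ (i, i) * entropy (node_state v i))"
proof -
  have "(global_norm M *\<^sub>v entropy_h (nglob M) v) $ i = global_norm M $$ (i, i) * entropy (node_state v i)"
    if i: "i < nglob M" for i
    by (subst global_norm_eq_diag)
      (use i in \<open>simp add: mat_diag_def scalar_prod_lessThan entropy_h_def if_distrib if_distribR cong: if_cong\<close>)
  moreover have "dim_row (global_norm M) = nglob M"
    unfolding global_norm_def by (rule carrier_matD(1)[OF assemble_dim])
  ultimately show ?thesis
    by (simp add: total_entropy_def ones_vec_def scalar_prod_lessThan)
qed

theorem theorem3:
  fixes M :: discretization
    and Fx Fy :: "real vec \<Rightarrow> real vec \<Rightarrow> real vec"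
    and A :: "nat \<Rightarrow> real vec \<Rightarrow> real mat"
    and T :: "real set"
    and u :: "real \<Rightarrow> real vec"
  assumes "sbp_discretization M"
    and "entropy_conservative_flux euler_flux_x potential_x Fx"
    and "entropy_conservative_flux euler_flux_y potential_y Fy"
    and "is_interval T" and "interior T \<noteq> {}"
    and "solves_semidiscretization M Fx Fy A T u"
    and "\<And>\<kappa> t. \<kappa> < nel M \<Longrightarrow> t \<in> T \<Longrightarrow>
           A \<kappa> (u t) \<in> carrier_mat (4 * nloc M \<kappa>) (4 * nloc M \<kappa>)"
    and "\<And>\<kappa> t. \<kappa> < nel M \<Longrightarrow> t \<in> T \<Longrightarrow>
           sym_pos_semidef (overbar (elem_norm M \<kappa>) * A \<kappa> (u t))"
  shows "\<forall>t \<in> T. \<exists>d. ((\<lambda>t. total_entropy M (u t)) has_real_derivative d) (at t within T) \<and> d \<le> 0"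
proof
  fix t assume t: "t \<in> T"
  let ?n = "nglob M" and ?h = "\<lambda>i. global_norm M $$ (i, i)"
  let ?W = "\<lambda>i. entropy_vars (node_state (u t) i)" and ?w = "entropy_vars_h (nglob M) (u t)"
  let ?fx = "hadamard (overbar (global_Dx M)) (flux_mat ?n Fx (u t)) *\<^sub>v ones_vec (4 * ?n)"
  let ?fy = "hadamard (overbar (global_Dy M)) (flux_mat ?n Fy (u t)) *\<^sub>v ones_vec (4 * ?n)"
  let ?B = "dissipation_mat M (\<lambda>\<kappa>. A \<kappa> (u t))"
  let ?g = "inv_mat (overbar (global_norm M)) * ?B *\<^sub>v ?w"
  have mesh: "periodic_mesh M" and cub: "cubature_rules M"
    and sbpx: "sbp_operators M (Sx M) (Ex M) (elem_Qx M)"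
    and sbpy: "sbp_operators M (Sy M) (Ey M) (elem_Qy M)"
    using assms(1) by (auto simp: sbp_discretization_def)
  obtain du where adm: "\<forall>i<?n. admissible (node_state (u t) i)"
    and du: "du \<in> carrier_vec (4 * ?n)" "vec_has_derivative u du (at t within T)"
    and eq: "du + ?fx + ?fy = - ?g"
    using assms(6) t unfolding solves_semidiscretization_def by blast
  have w: "?w \<in> carrier_vec (4 * ?n)"
    by (simp add: entropy_vars_h_def)
  have B: "?B \<in> carrier_mat (4 * ?n) (4 * ?n)"
    by (simp add: dissipation_mat_def mat_sum_def)
  \<comment> \<open>The witness is the rate that the nodal chain rule predicts.\<close>
  define d where "d = (\<Sum>i<?n. ?h i * (\<Sum>c<4. ?W i $ c * du $ (4 * i + c)))"
  have "((\<lambda>t. entropy (node_state (u t) i)) has_real_derivative (\<Sum>c<4. ?W i $ c * du $ (4 * i + c)))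
      (at t within T)" if i: "i < ?n" for i
  proof (rule entropy_has_derivative_along)
    fix c :: nat assume c: "c < 4"
    then show "((\<lambda>t. node_state (u t) i $ c) has_real_derivative du $ (4 * i + c)) (at t within T)"
      using du nat_block_less[OF i c] by (simp add: node_state_def vec_has_derivative_def)
  qed (use adm i in blast)
  then have deriv: "((\<lambda>t. total_entropy M (u t)) has_real_derivative d) (at t within T)"
    unfolding total_entropy_eq d_def by (intro DERIV_sum DERIV_cmult) auto
  have du_index: "du $ r = - ?fx $ r - ?fy $ r - ?g $ r" if r: "r < 4 * ?n" for r
  proof -
    \<comment> \<open>Indexing a vector sum requires the dimension of its right summand.
      \<open>kronecker_def\<close> is instantiated to products so that
      \<open>overbar (global_norm M)\<close> stays intact for
      \<open>inv_overbar_global_norm\<close>.\<close>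
    have dims: "dim_vec ?fx = 4 * ?n" "dim_vec ?fy = 4 * ?n" "dim_vec ?g = 4 * ?n"
      by (simp_all add: hadamard_def kronecker_def[of "_ * _"] global_Dx_def global_Dy_def mat_diag_def
          inv_overbar_global_norm[OF mesh cub] inv_global_norm[OF mesh cub])
    have "(du + ?fx + ?fy) $ r = (- ?g) $ r"
      by (simp only: eq)
    then show ?thesis
      using dims r by simp
  qed
  \<comment> \<open>The last sum uses entries of \<open>?w\<close> in place of \<open>?W i\<close>,
    to match \<open>norm_weighted_dissipation\<close>.\<close>
  have "d = - (\<Sum>i<?n. ?h i * (\<Sum>c<4. ?W i $ c * ?fx $ (4 * i + c)))
      - (\<Sum>i<?n. ?h i * (\<Sum>c<4. ?W i $ c * ?fy $ (4 * i + c)))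
      - (\<Sum>i<?n. ?h i * (\<Sum>c<4. ?w $ (4 * i + c) * ?g $ (4 * i + c)))"
  proof -
    have "?h i * (\<Sum>c<4. ?W i $ c * du $ (4 * i + c))
      = - (?h i * (\<Sum>c<4. ?W i $ c * ?fx $ (4 * i + c))) - ?h i * (\<Sum>c<4. ?W i $ c * ?fy $ (4 * i + c))
        - ?h i * (\<Sum>c<4. ?w $ (4 * i + c) * ?g $ (4 * i + c))" if i: "i < ?n" for i
    proof -
      have "?w $ (4 * i + c) = ?W i $ c" "4 * i + c < 4 * ?n" if "c < 4" for c
        using nat_block_less[OF i that] that by (simp_all add: entropy_vars_h_def)
      then have "(\<Sum>c<4. ?W i $ c * du $ (4 * i + c))
        = (\<Sum>c<4. - (?W i $ c * ?fx $ (4 * i + c)) - ?W i $ c * ?fy $ (4 * i + c)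
            - ?w $ (4 * i + c) * ?g $ (4 * i + c))"
        by (intro sum.cong refl) (simp only: lessThan_iff du_index right_diff_distrib mult_minus_right)
      then show ?thesis
        by (simp only: sum_subtractf sum_negf right_diff_distrib mult_minus_right)
    qed
    then show ?thesis
      unfolding d_def sum_negf[symmetric] sum_subtractf[symmetric] by (intro sum.cong refl) (simp only: lessThan_iff)
  qed
  also have "\<dots> = - (?w \<bullet> (?B *\<^sub>v ?w))"
    unfolding norm_weighted_dissipation[OF mesh cub B w] global_Dx_def global_Dy_def
    using norm_weighted_flux_sum_zero[OF mesh cub sbpx _ assms(2) adm]
      norm_weighted_flux_sum_zero[OF mesh cub sbpy _ assms(3) adm]
    by (simp add: elem_Qx_def elem_Qy_def)
  also have "\<dots> \<le> 0"
    using dissipation_nonneg[OF _ _ w, of "\<lambda>\<kappa>. A \<kappa> (u t)"] assms(7,8) t by simp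
  finally show "\<exists>d. ((\<lambda>t. total_entropy M (u t)) has_real_derivative d) (at t within T) \<and> d \<le> 0"
    using deriv by blast
qed

end
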